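(* Let $A_0,A_{\mathrm d}\in\mathbf{R}^{n\times n}$, $G=\begin{bmatrix}G_1&G_2\end{bmatrix}$ with $G_1,G_2\in\mathbf{R}^{n\times m}$, and consider the time-delay system $$\xi(k+1)=A_0\xi(k)+A_{\mathrm d}\xi(k-1)+Gv(k),\qquad k\ge 0,$$ with state $\xi(k)\in\mathbf{R}^n$, initial condition $\xi(0),\xi(-1)\in\mathbf{R}^n$, and control $v(k)=\begin{bmatrix}v_1(k)\\ v_2(k)\end{bmatrix}$, $v_1(k),v_2(k)\in\mathbf{R}^m$. This system can be equivalently written as the complex-valued linear system $$x(k+1)=\{A_1,A_2\}x(k)+\{B_1,B_2\}u(k),$$ where $$x(k)=\xi(k)+\mathrm{j}\,\xi(k-1),\qquad u(k)=v_1(k)+\mathrm{j}\,v_2(k),\qquad k\ge 0,$$ and $$\begin{aligned}A_1&=\tfrac12A_0+\tfrac{\mathrm j}{2}(I_n-A_{\mathrm d}),& B_1&=\tfrac12G_1-\tfrac{\mathrm j}{2}G_2,\\ A_2&=\tfrac12A_0-\tfrac{\mathrm j}{2}(I_n+A_{\mathrm d}),& B_2&=\tfrac12G_1-\tfrac{\mathrm j}{2}G_2.\end{aligned}$$ Moreover, let $Q_0\in\mathbf{R}^{n\times n}$ and $R_0\in\mathbf{R}^{2m\times 2m}$ be positive definite. If $R_0=\begin{bmatrix}R&0\\0&R\end{bmatrix}$ with $0<R\in\mathbf{R}^{m\times m}$, then the quadratic index function $$J(v)=\sum_{k=0}^{\infty}\left(\xi^{\mathrm T}(k)Q_0\xi(k)+v^{\mathrm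 T}(k)R_0v(k)\right)$$ can be written as $$J_1(u)=\sum_{k=0}^{\infty}\left(x^{\mathrm H}(k)Qx(k)+u^{\mathrm H}(k)Ru(k)\right)-\xi^{\mathrm T}(-1)Q\xi(-1),$$ where $Q=\tfrac12Q_0>0$.
   Context: $\mathrm{j}$ is the imaginary unit. For a complex matrix $M$, $M^{\#}$, $M^{\mathrm T}$, $M^{\mathrm H}$ denote its (entrywise) conjugate, transpose and conjugate transpose. For $M_1,M_2\in\mathbf{C}^{p\times q}$ the bimatrix $\{M_1,M_2\}$ acts on $x\in\mathbf{C}^q$ by $\{M_1,M_2\}x=M_1x+M_2^{\#}x^{\#}$. Real positive definite matrices are symmetric. *)

theory Defs
  imports "HOL-Analysis.Analysis"
begin

definition cvec :: "real^'n \<Rightarrow> complex^'n" where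
  "cvec x = (\<chi> i. complex_of_real (x $ i))"

definition cmat :: "real^'n^'m \<Rightarrow> complex^'n^'m" where
  "cmat M = map_matrix complex_of_real M"

definition vec_cnj :: "complex^'n \<Rightarrow> complex^'n" where
  "vec_cnj x = (\<chi> i. cnj (x $ i))"

definition mat_scale :: "complex \<Rightarrow> complex^'n^'m \<Rightarrow> complex^'n^'m" where
  "mat_scale c M = map_matrix (\<lambda>z. c * z) M"

(* {M1, M2} x, which is real-linear but in general not complex-linear in x *)
definition bimatrix_apply :: "complex^'q^'p \<Rightarrow> complex^'q^'p \<Rightarrow> complex^'q \<Rightarrow> complex^'p" where
  "bimatrix_apply M1 M2 x = M1 *v x + map_matrix cnj M2 *v vec_cnj x"

(* The index type 'm + 'm realises dimension 2m: Inl indexes the first block, Inr the second. *)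
definition hcat :: "real^'m^'n \<Rightarrow> real^'m^'n \<Rightarrow> real^('m + 'm)^'n" where
  "hcat G1 G2 = (\<chi> i j. case j of Inl a \<Rightarrow> G1 $ i $ a | Inr b \<Rightarrow> G2 $ i $ b)"

definition vstack :: "real^'m \<Rightarrow> real^'m \<Rightarrow> real^('m + 'm)" where
  "vstack v1 v2 = (\<chi> j. case j of Inl a \<Rightarrow> v1 $ a | Inr b \<Rightarrow> v2 $ b)"

definition block_diag :: "real^'m^'m \<Rightarrow> real^'m^'m \<Rightarrow> real^('m + 'm)^('m + 'm)" where
  "block_diag P S = (\<chi> i j. case (i, j) of
       (Inl a, Inl b) \<Rightarrow> P $ a $ b
     | (Inr a, Inr b) \<Rightarrow> S $ a $ b
     | _ \<Rightarrow> 0)"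

definition pos_def :: "real^'n^'n \<Rightarrow> bool" where
  "pos_def M \<longleftrightarrow> transpose M = M \<and> (\<forall>x. x \<noteq> 0 \<longrightarrow> x \<bullet> (M *v x) > 0)"

(* x^H M x *)
definition herm_form :: "complex^'n^'n \<Rightarrow> complex^'n \<Rightarrow> complex" where
  "herm_form M x = (\<Sum>i\<in>UNIV. cnj (x $ i) * (M *v x) $ i)"

(* States are indexed by int because xi(-1) is part of the initial condition;
   only the values at indices >= -1 are constrained. *)
definition delay_system ::
  "real^'n^'n \<Rightarrow> real^'n^'n \<Rightarrow> real^'p^'n \<Rightarrow> (int \<Rightarrow> real^'n) \<Rightarrow> (nat \<Rightarrow> real^'p) \<Rightarrow> bool" where
  "delay_system A0 Ad G \<xi> v \<longleftrightarrow>
     (\<forall>k. \<xi> (int k + 1) = A0 *v \<xi> (int k) + Ad *v \<xi> (int k - 1) + G *v v k)"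

definition bimatrix_system ::
  "complex^'n^'n \<Rightarrow> complex^'n^'n \<Rightarrow> complex^'m^'n \<Rightarrow> complex^'m^'n
     \<Rightarrow> (nat \<Rightarrow> complex^'n) \<Rightarrow> (nat \<Rightarrow> complex^'m) \<Rightarrow> bool" where
  "bimatrix_system A1 A2 B1 B2 x u \<longleftrightarrow>
     (\<forall>k. x (k + 1) = bimatrix_apply A1 A2 (x k) + bimatrix_apply B1 B2 (u k))"

definition complex_state :: "(int \<Rightarrow> real^'n) \<Rightarrow> nat \<Rightarrow> complex^'n" where
  "complex_state \<xi> k = cvec (\<xi> (int k)) + \<i> *s cvec (\<xi> (int k - 1))"

definition complex_input :: "(nat \<Rightarrow> real^'m) \<Rightarrow> (nat \<Rightarrow> real^'m) \<Rightarrow> nat \<Rightarrow> complex^'m" where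
  "complex_input v1 v2 k = cvec (v1 k) + \<i> *s cvec (v2 k)"

definition stacked_input :: "(nat \<Rightarrow> real^'m) \<Rightarrow> (nat \<Rightarrow> real^'m) \<Rightarrow> nat \<Rightarrow> real^('m + 'm)" where
  "stacked_input v1 v2 k = vstack (v1 k) (v2 k)"

(* The index functions may diverge, hence the extended real values. *)
definition cost_J ::
  "real^'n^'n \<Rightarrow> real^'p^'p \<Rightarrow> (int \<Rightarrow> real^'n) \<Rightarrow> (nat \<Rightarrow> real^'p) \<Rightarrow> ereal" where
  "cost_J Q0 R0 \<xi> v =
     (\<Sum>k. ereal (\<xi> (int k) \<bullet> (Q0 *v \<xi> (int k)) + v k \<bullet> (R0 *v v k)))"

(* xm1 stands for xi(-1). For symmetric Q and R the Hermitian forms are real,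
   so that Re only performs the change of type. *)
definition cost_J1 ::
  "real^'n^'n \<Rightarrow> real^'m^'m \<Rightarrow> (nat \<Rightarrow> complex^'n) \<Rightarrow> (nat \<Rightarrow> complex^'m) \<Rightarrow> real^'n \<Rightarrow> ereal" where
  "cost_J1 Q R x u xm1 =
     (\<Sum>k. ereal (Re (herm_form (cmat Q) (x k) + herm_form (cmat R) (u k))))
       - ereal (xm1 \<bullet> (Q *v xm1))"

end

theory Submission
  imports Defs
begin

text \<open>For \<open>x = p + \<i>q\<close> one has \<open>{M, N} x = (M + N\<^sup>#) p + \<i> (M - N\<^sup>#) q\<close>, and the coefficients are chosen so that
  the real part reproduces the delay equation while the imaginary part is the shift \<open>p\<close>.
  The Hermitian form of a real symmetric matrix splits over real and imaginary parts, so the state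
  cost counts every \<open>\<xi>(k)\<close> with \<open>k \<ge> 0\<close> twice with weight \<open>Q\<^sub>0/2\<close>, and \<open>\<xi>(-1)\<close> once.\<close>

text \<open>Real coordinates on \<open>complex^'n\<close>: an identity of complex vectors becomes a
  pair of real ones. Both \<open>complex_state\<close> and \<open>complex_input\<close> have this
  shape.\<close>

definition cplx_vec :: "real^'n \<Rightarrow> real^'n \<Rightarrow> complex^'n" where
  "cplx_vec p q = cvec p + \<i> *s cvec q"

lemma Re_cplx_vec [simp]: "Re (cplx_vec p q $ i) = p $ i"
  and Im_cplx_vec [simp]: "Im (cplx_vec p q $ i) = q $ i"
  by (simp_all add: cplx_vec_def cvec_def)

lemma cplx_vec_eq_iff: "cplx_vec p q = cplx_vec p' q' \<longleftrightarrow> p = p' \<and> q = q'"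
  by (auto simp: vec_eq_iff complex_eq_iff)

lemma cplx_vec_surj: "x = cplx_vec (\<chi> i. Re (x $ i)) (\<chi> i. Im (x $ i))"
  by (simp add: vec_eq_iff complex_eq_iff)

lemma cplx_vec_add: "cplx_vec p q + cplx_vec p' q' = cplx_vec (p + p') (q + q')"
  by (simp add: vec_eq_iff complex_eq_iff)

lemma cmat_mult_cplx_vec: "cmat M *v cplx_vec p q = cplx_vec (M *v p) (M *v q)"
  by (simp add: vec_eq_iff complex_eq_iff cmat_def matrix_vector_mult_def)

lemma mat_scale_mult: "mat_scale c M *v x = c *s (M *v x)"
  by (simp add: vec_eq_iff mat_scale_def matrix_vector_mult_def sum_distrib_left mult.assoc)

lemma vec_cnj_cplx_vec: "vec_cnj (cplx_vec p q) = cplx_vec p (- q)"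
  by (simp add: vec_eq_iff complex_eq_iff vec_cnj_def)

lemma cnj_add: "map_matrix cnj (M + N) = map_matrix cnj M + map_matrix cnj N"
  and cnj_diff: "map_matrix cnj (M - N) = map_matrix cnj M - map_matrix cnj N"
  and cnj_mat_scale: "map_matrix cnj (mat_scale c M) = mat_scale (cnj c) (map_matrix cnj M)"
  and cnj_cmat: "map_matrix cnj (cmat K) = cmat K"
  by (simp_all add: vec_eq_iff mat_scale_def cmat_def)

text \<open>Brings the identity in \<open>A1\<close> and \<open>A2\<close> into the form to which
  \<open>cnj_cmat\<close> and \<open>cmat_mult_cplx_vec\<close> apply.\<close>

lemma mat_1_cmat: "(mat 1 :: complex^'n^'n) = cmat (mat 1)"
  by (simp add: vec_eq_iff cmat_def mat_def)

lemmas bimatrix_simps =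
  bimatrix_apply_def vec_cnj_cplx_vec cnj_add cnj_diff cnj_mat_scale cnj_cmat mat_1_cmat
  matrix_vector_mult_add_rdistrib matrix_vector_mult_diff_rdistrib mat_scale_mult
  cmat_mult_cplx_vec

text \<open>Here \<open>A1 + A2\<^sup># = A0 + \<i> I\<close> acts on \<open>p\<close>, while
  \<open>\<i> (A1 - A2\<^sup>#) = Ad\<close> acts on \<open>q\<close>.\<close>

lemma bimatrix_apply_state:
  fixes A0 Ad :: "real^'n^'n"
  assumes "A1 = mat_scale (1/2) (cmat A0) + mat_scale (\<i>/2) (mat 1 - cmat Ad)"
    and "A2 = mat_scale (1/2) (cmat A0) - mat_scale (\<i>/2) (mat 1 + cmat Ad)"
  shows "bimatrix_apply A1 A2 (cplx_vec p q) = cplx_vec (A0 *v p + Ad *v q) p"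
  unfolding assms
  by (simp add: bimatrix_simps vec.neg) (simp add: vec_eq_iff complex_eq_iff field_simps)

text \<open>Here \<open>B1 + B2\<^sup># = G1\<close> and \<open>\<i> (B1 - B2\<^sup>#) = G2\<close>
  are both real, so the input leaves the imaginary component, which stores the delayed state,
  untouched.\<close>

lemma bimatrix_apply_input:
  fixes G1 G2 :: "real^'m^'n"
  assumes "B1 = mat_scale (1/2) (cmat G1) - mat_scale (\<i>/2) (cmat G2)"
    and "B2 = mat_scale (1/2) (cmat G1) - mat_scale (\<i>/2) (cmat G2)"
  shows "bimatrix_apply B1 B2 (cplx_vec p q) = cplx_vec (G1 *v p + G2 *v q) 0"
  unfolding assms
  by (simp add: bimatrix_simps vec.neg) (simp add: vec_eq_iff complex_eq_iff field_simps)

lemma sum_UNIV_Plus: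
  fixes f :: "'a::finite + 'b::finite \<Rightarrow> 'c::comm_monoid_add"
  shows "sum f UNIV = (\<Sum>a\<in>UNIV. f (Inl a)) + (\<Sum>b\<in>UNIV. f (Inr b))"
  unfolding UNIV_Plus_UNIV[symmetric] by (subst sum.Plus) auto

lemma hcat_mult_vstack: "hcat G1 G2 *v vstack a b = G1 *v a + G2 *v b"
  by (simp add: vec_eq_iff matrix_vector_mult_def hcat_def vstack_def sum_UNIV_Plus)

lemma vstack_block_diag_form:
  "vstack a b \<bullet> (block_diag P S *v vstack a b) = a \<bullet> (P *v a) + b \<bullet> (S *v b)"
  by (simp add: inner_vec_def matrix_vector_mult_def block_diag_def vstack_def sum_UNIV_Plus)

text \<open>Expanding the form at \<open>p + \<i> q\<close> leaves the cross terms
  \<open>\<i> (p \<bullet> (M *v q) - q \<bullet> (M *v p))\<close>, which cancel by symmetry of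
  \<open>M\<close>.\<close>

lemma herm_form_cplx_vec:
  assumes "transpose M = M"
  shows "herm_form (cmat M) (cplx_vec p q) = complex_of_real (p \<bullet> (M *v p) + q \<bullet> (M *v q))"
proof -
  have "p \<bullet> (M *v q) = q \<bullet> (M *v p)"
    using dot_lmul_matrix[of p M q] transpose_matrix_vector[of M p] assms
    by (simp add: inner_commute)
  then show ?thesis
    by (simp add: complex_eq_iff herm_form_def cmat_mult_cplx_vec inner_vec_def
        sum.distrib sum_subtractf)
qed

text \<open>Justifies the \<open>Re\<close> in \<open>cost_J1\<close>: it discards nothing.\<close>

lemma herm_form_real:
  assumes "transpose M = M"
  shows "herm_form (cmat M) x \<in> \<real>"
  by (subst cplx_vec_surj[of x]) (simp only: herm_form_cplx_vec[OF assms] Reals_of_real)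

lemma pos_def_nonneg: "pos_def M \<Longrightarrow> 0 \<le> x \<bullet> (M *v x)"
  by (cases "x = 0") (auto simp: pos_def_def less_imp_le)

lemma scaleR_quadratic_form:
  fixes M :: "real^'n^'n"
  shows "x \<bullet> ((c *\<^sub>R M) *v x) = c * (x \<bullet> (M *v x))"
  by (simp add: scaleR_matrix_vector_assoc[symmetric])

lemma pos_def_scaleR:
  assumes "pos_def M" "c > 0"
  shows "pos_def (c *\<^sub>R M)"
  using assms by (simp add: pos_def_def scaleR_quadratic_form transpose_scalar)

text \<open>Nonnegativity makes the tail summable in \<open>ereal\<close>, possibly with value
  infinity. Since the head is finite, addition is continuous even there, so the limit of the partial
  sums can be taken termwise.\<close>

lemma suminf_ereal_split_head:
  fixes a :: "nat \<Rightarrow> real"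
  assumes "\<And>k. 0 \<le> a k"
  shows "(\<Sum>k. ereal (a k)) = ereal (a 0) + (\<Sum>k. ereal (a (Suc k)))"
proof -
  have "(\<lambda>k. ereal (a (Suc k))) sums (\<Sum>k. ereal (a (Suc k)))"
    by (intro summable_sums summable_ereal_pos) (simp add: assms)
  then have "(\<lambda>n. ereal (a 0) + (\<Sum>k<n. ereal (a (Suc k))))
      \<longlonglongrightarrow> ereal (a 0) + (\<Sum>k. ereal (a (Suc k)))"
    unfolding sums_def by (intro tendsto_add_ereal_general) auto
  then have "(\<lambda>n. \<Sum>k<Suc n. ereal (a k)) \<longlonglongrightarrow> ereal (a 0) + (\<Sum>k. ereal (a (Suc k)))"
    by (simp only: sum.lessThan_Suc_shift)
  then have "(\<lambda>k. ereal (a k)) sums (ereal (a 0) + (\<Sum>k. ereal (a (Suc k))))"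
    unfolding sums_def by (rule LIMSEQ_imp_Suc)
  then show ?thesis
    by (rule sums_unique[symmetric])
qed

text \<open>Telescoping the partial sums would leave a remainder \<open>a n\<close>, which need not vanish when the
  series diverge; the nonnegative series are therefore split instead.\<close>

lemma suminf_ereal_half_shift:
  fixes a b :: "nat \<Rightarrow> real"
  assumes a: "\<And>k. 0 \<le> a k" and b: "\<And>k. 0 \<le> b k"
  shows "(\<Sum>k. ereal (2 * a (Suc k) + b k))
    = (\<Sum>k. ereal (a (Suc k) + a k + b k)) - ereal (a 0)"
proof -
  \<comment> \<open>The part common to both series; what remains is the sum of \<open>a\<close> with
    and without its head.\<close>
  let ?F = "\<lambda>k. ereal (a (Suc k) + b k)"
  have "(\<Sum>k. ereal (2 * a (Suc k) + b k)) = (\<Sum>k. ?F k + ereal (a (Suc k)))"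
    by (simp add: algebra_simps)
  also have "\<dots> = (\<Sum>k. ?F k) + (\<Sum>k. ereal (a (Suc k)))"
    by (rule suminf_add_ereal) (simp_all add: a b)
  finally have lhs: "(\<Sum>k. ereal (2 * a (Suc k) + b k)) = (\<Sum>k. ?F k) + (\<Sum>k. ereal (a (Suc k)))" .
  have "(\<Sum>k. ereal (a (Suc k) + a k + b k)) = (\<Sum>k. ?F k + ereal (a k))"
    by (simp add: algebra_simps)
  also have "\<dots> = (\<Sum>k. ?F k) + (\<Sum>k. ereal (a k))"
    by (rule suminf_add_ereal) (simp_all add: a b)
  also have "\<dots> = (\<Sum>k. ereal (2 * a (Suc k) + b k)) + ereal (a 0)"
    unfolding lhs suminf_ereal_split_head[of a, OF a] by (simp only: ac_simps)
  \<comment> \<open>Moving \<open>ereal (a 0)\<close> across is sound because it is finite, even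
    when both series are infinite.\<close>
  finally show ?thesis
    by (simp add: ereal_diff_add_inverse add.commute)
qed

lemma complex_state_eq: "complex_state \<xi> k = cplx_vec (\<xi> (int k)) (\<xi> (int k - 1))"
  by (simp add: complex_state_def cplx_vec_def)

lemma complex_input_eq: "complex_input v1 v2 k = cplx_vec (v1 k) (v2 k)"
  by (simp add: complex_input_def cplx_vec_def)

lemma cost_J_eq_cost_J1:
  fixes Q0 :: "real^'n^'n" and R :: "real^'m^'m"
  assumes Q0: "pos_def Q0" and R: "pos_def R"
  shows "cost_J Q0 (block_diag R R) \<xi> (stacked_input v1 v2)
    = cost_J1 ((1/2) *\<^sub>R Q0) R (complex_state \<xi>) (complex_input v1 v2) (\<xi> (- 1))"
proof -
  let ?Q = "(1/2) *\<^sub>R Q0"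
  \<comment> \<open>The index is shifted by one, so that \<open>a 0\<close> is the cost of
    \<open>\<xi> (- 1)\<close> and \<open>a (Suc k)\<close> that of
    \<open>\<xi> (int k)\<close>.\<close>
  define a where "a k = \<xi> (int k - 1) \<bullet> (?Q *v \<xi> (int k - 1))" for k
  define b where "b k = v1 k \<bullet> (R *v v1 k) + v2 k \<bullet> (R *v v2 k)" for k
  have Q: "pos_def ?Q"
    using Q0 by (rule pos_def_scaleR) simp
  have sym: "transpose ?Q = ?Q" "transpose R = R"
    using Q R by (simp_all add: pos_def_def)
  have J: "cost_J Q0 (block_diag R R) \<xi> (stacked_input v1 v2) = (\<Sum>k. ereal (2 * a (Suc k) + b k))"
    by (simp add: cost_J_def stacked_input_def vstack_block_diag_form a_def b_def
        scaleR_quadratic_form)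
  have "Re (herm_form (cmat ?Q) (complex_state \<xi> k) + herm_form (cmat R) (complex_input v1 v2 k))
      = a (Suc k) + a k + b k" for k
    unfolding complex_state_eq complex_input_eq herm_form_cplx_vec[OF sym(1)]
      herm_form_cplx_vec[OF sym(2)]
    by (simp add: a_def b_def)
  then have J1: "cost_J1 ?Q R (complex_state \<xi>) (complex_input v1 v2) (\<xi> (- 1))
      = (\<Sum>k. ereal (a (Suc k) + a k + b k)) - ereal (a 0)"
    by (simp add: cost_J1_def a_def)
  show ?thesis
    unfolding J J1
    by (rule suminf_ereal_half_shift) (simp_all add: a_def b_def pos_def_nonneg Q R)
qed

theorem proposition2:
  fixes A0 Ad :: "real^'n^'n"
    and G1 G2 :: "real^'m^'n"
    and G :: "real^('m + 'm)^'n"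
    and A1 A2 :: "complex^'n^'n"
    and B1 B2 :: "complex^'m^'n"
  assumes G: "G = hcat G1 G2"
    and A1: "A1 = mat_scale (1/2) (cmat A0) + mat_scale (\<i>/2) (mat 1 - cmat Ad)"
    and A2: "A2 = mat_scale (1/2) (cmat A0) - mat_scale (\<i>/2) (mat 1 + cmat Ad)"
    and B1: "B1 = mat_scale (1/2) (cmat G1) - mat_scale (\<i>/2) (cmat G2)"
    and B2: "B2 = mat_scale (1/2) (cmat G1) - mat_scale (\<i>/2) (cmat G2)"
  shows
    "(\<forall>\<xi> v1 v2.
        delay_system A0 Ad G \<xi> (stacked_input v1 v2)
        \<longleftrightarrow> bimatrix_system A1 A2 B1 B2 (complex_state \<xi>) (complex_input v1 v2))
     \<and> (\<forall>x u. bimatrix_system A1 A2 B1 B2 x u \<longrightarrow>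
          (\<exists>\<xi> v1 v2. delay_system A0 Ad G \<xi> (stacked_input v1 v2)
             \<and> x = complex_state \<xi> \<and> u = complex_input v1 v2))
     \<and> (\<forall>(Q0 :: real^'n^'n) (R0 :: real^('m + 'm)^('m + 'm)) (R :: real^'m^'m) (Q :: real^'n^'n).
          pos_def Q0 \<longrightarrow> pos_def R0 \<longrightarrow> pos_def R \<longrightarrow> R0 = block_diag R R \<longrightarrow>
          Q = (1/2) *\<^sub>R Q0 \<longrightarrow>
          pos_def Q
          \<and> (\<forall>x. herm_form (cmat Q) x \<in> \<real>)
          \<and> (\<forall>u. herm_form (cmat R) u \<in> \<real>)
          \<and> (\<forall>\<xi> v1 v2. delay_system A0 Ad G \<xi> (stacked_input v1 v2) \<longrightarrow>
               cost_J Q0 R0 \<xi> (stacked_input v1 v2)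
                 = cost_J1 Q R (complex_state \<xi>) (complex_input v1 v2) (\<xi> (- 1))))"
proof -
  \<comment> \<open>For a state built from \<open>\<xi>\<close> the imaginary component reads
    \<open>\<xi> (int k) = \<xi> (int k)\<close>, so only the real one, the delay equation, is a
    constraint.\<close>
  have step: "complex_state \<xi> (k + 1)
        = bimatrix_apply A1 A2 (complex_state \<xi> k) + bimatrix_apply B1 B2 (complex_input v1 v2 k)
      \<longleftrightarrow> \<xi> (int k + 1) = A0 *v \<xi> (int k) + Ad *v \<xi> (int k - 1) + G *v stacked_input v1 v2 k"
    for \<xi> v1 v2 k
    unfolding complex_state_eq complex_input_eq bimatrix_apply_state[OF A1 A2]
      bimatrix_apply_input[OF B1 B2] cplx_vec_add cplx_vec_eq_iff G stacked_input_def
      hcat_mult_vstack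
    by (simp add: ac_simps)
  have equiv: "delay_system A0 Ad G \<xi> (stacked_input v1 v2)
      \<longleftrightarrow> bimatrix_system A1 A2 B1 B2 (complex_state \<xi>) (complex_input v1 v2)" for \<xi> v1 v2
    by (simp only: delay_system_def bimatrix_system_def step)
  have realise: "\<exists>\<xi> v1 v2. delay_system A0 Ad G \<xi> (stacked_input v1 v2)
      \<and> x = complex_state \<xi> \<and> u = complex_input v1 v2"
    if sys: "bimatrix_system A1 A2 B1 B2 x u" for x u
  proof -
    define p q where "p k = (\<chi> i. Re (x k $ i))" and "q k = (\<chi> i. Im (x k $ i))" for k
    define v1 v2 where "v1 k = (\<chi> i. Re (u k $ i))" and "v2 k = (\<chi> i. Im (u k $ i))" for k
    \<comment> \<open>The initial imaginary part supplies \<open>\<xi> (- 1)\<close>; the value at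
      indices below -1 is arbitrary.\<close>
    define \<xi> where "\<xi> k = (if k < 0 then q 0 else p (nat k))" for k :: int
    have x: "x k = cplx_vec (p k) (q k)" for k
      unfolding p_def q_def by (rule cplx_vec_surj)
    have u: "u k = cplx_vec (v1 k) (v2 k)" for k
      unfolding v1_def v2_def by (rule cplx_vec_surj)
    \<comment> \<open>The imaginary component of the system equation makes \<open>q\<close> the
      delayed copy of \<open>p\<close>, so an arbitrary complex trajectory does come from one real
      sequence.\<close>
    have q_Suc: "q (Suc k) = p k" for k
      using sys unfolding bimatrix_system_def x u bimatrix_apply_state[OF A1 A2]
        bimatrix_apply_input[OF B1 B2] cplx_vec_add cplx_vec_eq_iff
      by simp
    have "x k = complex_state \<xi> k" for k
      unfolding complex_state_eq x cplx_vec_eq_iff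
      by (cases k) (simp_all add: \<xi>_def q_Suc nat_add_distrib)
    moreover have "u k = complex_input v1 v2 k" for k
      by (simp add: u complex_input_eq)
    ultimately have "x = complex_state \<xi>" "u = complex_input v1 v2"
      by blast+
    with sys equiv show ?thesis
      by blast
  qed
  show ?thesis
  proof (intro conjI allI impI)
    show "delay_system A0 Ad G \<xi> (stacked_input v1 v2)
        \<longleftrightarrow> bimatrix_system A1 A2 B1 B2 (complex_state \<xi>) (complex_input v1 v2)" for \<xi> v1 v2
      by (rule equiv)
  next
    fix x u assume "bimatrix_system A1 A2 B1 B2 x u"
    then show "\<exists>\<xi> v1 v2. delay_system A0 Ad G \<xi> (stacked_input v1 v2)
        \<and> x = complex_state \<xi> \<and> u = complex_input v1 v2"
      by (rule realise)
  next
    fix Q0 Q :: "real^'n^'n" and R0 :: "real^('m + 'm)^('m + 'm)" and R :: "real^'m^'m"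
    assume Q0: "pos_def Q0" and R: "pos_def R" and R0: "R0 = block_diag R R"
      and Q: "Q = (1/2) *\<^sub>R Q0"
    show posQ: "pos_def Q"
      unfolding Q using Q0 by (rule pos_def_scaleR) simp
    show "herm_form (cmat Q) x \<in> \<real>" for x
      using posQ by (intro herm_form_real) (simp add: pos_def_def)
    show "herm_form (cmat R) u \<in> \<real>" for u
      using R by (intro herm_form_real) (simp add: pos_def_def)
    show "cost_J Q0 R0 \<xi> (stacked_input v1 v2)
        = cost_J1 Q R (complex_state \<xi>) (complex_input v1 v2) (\<xi> (- 1))" for \<xi> v1 v2
      unfolding R0 Q by (rule cost_J_eq_cost_J1[OF Q0 R])
  qed
qed

end
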